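(* Let $n$ be a positive integer, let $\mathcal{C}$ be the class of binary matroids with at most $n$ elements, and let $\mathbf{BigM}=\mathbb{F}_2^n$ be the complete binary matroid of rank $n$. Then there exists an online matroid morphism (OMM) for $\mathcal{C}$ into $\mathbf{BigM}$.
   Context: All matroids have finite ground sets; a matroid and its ground set are denoted by the same letter, with rank function $\mathrm{rank}_{\mathbf{M}}$. A (matroid) morphism $f:\mathbf{M}\to\mathbf{N}$ is a map between ground sets with $\mathrm{rank}_{\mathbf{N}}(f(S))=\mathrm{rank}_{\mathbf{M}}(S)$ for all $S\subseteq \mathbf{M}$; it is a monomorphism (embedding) if injective. The complete binary matroid $\mathbb{F}_2^n$ has as ground set all vectors of $\mathbb{F}_2^n$ (including $0$), a set being independent iff it is a linearly independent set of vectors. A matroid is binary if it admits a morphism into $\mathbb{F}_2^d$ for some $d$. An ordering of $\mathbf{M}$ (with $|\mathbf{M}|=m$) is a bijection $\pi:[m]\to\mathbf{M}$. For $m'<m$, the prefix-restriction $(\mathbf{M}',\pi')$ of $(\mathbf{M},\pi)$ is the restriction of $\mathbf{M}$ to $\pi([m'])$ together with $\pi'=\pi|_{[m']}$. For a class $\mathcal{C}$ of matroids closed under restriction, an online matroid morphism for $\mathcal{C}$ into a host matroid $\mathbf{BigM}$ is a family of morphisms $f_{\mathbf{M},\pi}:\mathbf{M}\to\mathbf{BigM}$, one for each $\mathbf{M}\in\mathcal{C}$ and each ordering $\pi$ of $\mathbf{M}$, such that for every prefix-restriction $(\mathbf{M}',\pi')$ of $(\mathbf{M},\pi)$, $f_{\mathbf{M}',\pi'}$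 equals the restriction of $f_{\mathbf{M},\pi}$ to $\mathbf{M}'$. *)

theory Defs
  imports Complex_Main "HOL-Library.FuncSet" "HOL-Library.Function_Algebras" "HOL-Library.Z2"
begin

record 'a matroid =
  ground :: "'a set"
  indep :: "'a set set"

locale matroid =
  fixes M :: "'a matroid"
  assumes finite_ground: "finite (ground M)"
    and indep_subset: "X \<in> indep M \<Longrightarrow> X \<subseteq> ground M"
    and empty_indep: "{} \<in> indep M"
    and indep_mono: "X \<in> indep M \<Longrightarrow> Y \<subseteq> X \<Longrightarrow> Y \<in> indep M"
    and augment: "X \<in> indep M \<Longrightarrow> Y \<in> indep M \<Longrightarrow> card X < card Y \<Longrightarrow>
      \<exists>y\<in>Y - X. insert y X \<in> indep M"

definition mrank :: "'a matroid \<Rightarrow> 'a set \<Rightarrow> nat" where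
  "mrank M S = Max (card ` {X. X \<subseteq> S \<and> X \<in> indep M})"

definition mrestrict :: "'a matroid \<Rightarrow> 'a set \<Rightarrow> 'a matroid" where
  "mrestrict M S = \<lparr>ground = ground M \<inter> S, indep = {X \<in> indep M. X \<subseteq> S}\<rparr>"

text \<open>Maps between ground sets are extensional functions, so that two morphisms on the same
  matroid are equal iff they agree on its ground set.\<close>

definition matroid_morphism :: "'a matroid \<Rightarrow> 'b matroid \<Rightarrow> ('a \<Rightarrow> 'b) \<Rightarrow> bool" where
  "matroid_morphism M N f \<longleftrightarrow>
     f \<in> ground M \<rightarrow>\<^sub>E ground N \<and> (\<forall>S\<subseteq>ground M. mrank N (f ` S) = mrank M S)"

text \<open>Vectors over the two-element field are functions \<^typ>\<open>nat \<Rightarrow> bit\<close>, and the \<open>n\<close>-dimensional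
  space consists of those that vanish at all indices \<open>\<ge> n\<close>. As it is a subspace of
  the space of all functions, linear independence may be taken in the latter.\<close>

definition bscale :: "bit \<Rightarrow> (nat \<Rightarrow> bit) \<Rightarrow> nat \<Rightarrow> bit" where
  "bscale c v = (\<lambda>i. c * v i)"

global_interpretation bvec: vector_space bscale
  by unfold_locales (auto simp: bscale_def fun_eq_iff algebra_simps)

definition complete_binary :: "nat \<Rightarrow> (nat \<Rightarrow> bit) matroid" where
  "complete_binary n = (let V = {v. \<forall>i\<ge>n. v i = 0} in
     \<lparr>ground = V, indep = {X. X \<subseteq> V \<and> \<not> bvec.dependent X}\<rparr>)"

definition binary :: "'a matroid \<Rightarrow> bool" where
  "binary M \<longleftrightarrow> (\<exists>d f. matroid_morphism M (complete_binary d) f)"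

definition binary_matroids :: "nat \<Rightarrow> 'a matroid set" where
  "binary_matroids n = {M. matroid M \<and> binary M \<and> card (ground M) \<le> n}"

text \<open>Orderings are extensional as well: an ordering must carry no information beyond its
  values on \<open>{1..m}\<close>, since the members of an online morphism may depend on it.\<close>

definition ordering :: "'a matroid \<Rightarrow> (nat \<Rightarrow> 'a) \<Rightarrow> bool" where
  "ordering M \<pi> \<longleftrightarrow>
     \<pi> \<in> extensional {1..card (ground M)} \<and> bij_betw \<pi> {1..card (ground M)} (ground M)"

text \<open>Meant for classes \<open>C\<close> that are closed under restriction, so that the prefix-restrictions
  of a member of \<open>C\<close> are again in \<open>C\<close>.\<close>

definition online_morphism ::
  "'a matroid set \<Rightarrow> 'b matroid \<Rightarrow> ('a matroid \<Rightarrow> (nat \<Rightarrow> 'a) \<Rightarrow> 'a \<Rightarrow> 'b) \<Rightarrow> bool" where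
  "online_morphism C B f \<longleftrightarrow>
     (\<forall>M\<in>C. \<forall>\<pi>. ordering M \<pi> \<longrightarrow>
        matroid_morphism M B (f M \<pi>) \<and>
        (\<forall>k<card (ground M).
           f (mrestrict M (\<pi> ` {1..k})) (restrict \<pi> {1..k}) = restrict (f M \<pi>) (\<pi> ` {1..k})))"

lemma finite_bvec_space: "finite {v :: nat \<Rightarrow> bit. \<forall>i\<ge>n. v i = 0}"
proof -
  have "finite {v :: nat \<Rightarrow> bit. \<forall>i. (i \<in> {..<n} \<longrightarrow> v i \<in> {0, 1}) \<and> (i \<notin> {..<n} \<longrightarrow> v i = 0)}"
    by (rule finite_set_of_finite_funs) auto
  moreover have "{v :: nat \<Rightarrow> bit. \<forall>i\<ge>n. v i = 0} \<subseteq>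
      {v. \<forall>i. (i \<in> {..<n} \<longrightarrow> v i \<in> {0, 1}) \<and> (i \<notin> {..<n} \<longrightarrow> v i = 0)}"
    by (auto simp: not_less)
  ultimately show ?thesis
    by (rule rev_finite_subset)
qed

lemma matroid_complete_binary: "matroid (complete_binary n)"
proof
  fix X Y
  assume X: "X \<in> indep (complete_binary n)" and Y: "Y \<in> indep (complete_binary n)"
    and less: "card X < card Y"
  have fin: "finite X"
    using X finite_bvec_space[of n] by (auto simp: complete_binary_def Let_def intro: finite_subset)
  have "\<not> Y \<subseteq> bvec.span X"
    using bvec.independent_span_bound[OF fin, of Y] Y less by (auto simp: complete_binary_def Let_def)
  then obtain y where y: "y \<in> Y" "y \<notin> bvec.span X"
    by blast
  then have "y \<notin> X" "\<not> bvec.dependent (insert y X)"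
    using X by (auto simp: complete_binary_def Let_def bvec.span_base bvec.independent_insert)
  then show "\<exists>y\<in>Y - X. insert y X \<in> indep (complete_binary n)"
    using X Y y by (auto simp: complete_binary_def Let_def)
qed (auto simp: complete_binary_def Let_def finite_bvec_space bvec.independent_empty
       dest: bvec.dependent_mono)

lemma matroid_mrestrict:
  assumes "matroid M"
  shows "matroid (mrestrict M S)"
proof -
  interpret matroid M by fact
  show ?thesis
  proof
    fix X Y
    assume X: "X \<in> indep (mrestrict M S)" and Y: "Y \<in> indep (mrestrict M S)"
      and "card X < card Y"
    then obtain y where "y \<in> Y - X" "insert y X \<in> indep M"
      using augment[of X Y] by (auto simp: mrestrict_def)
    then show "\<exists>y\<in>Y - X. insert y X \<in> indep (mrestrict M S)"
      using X Y by (auto simp: mrestrict_def)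
  qed (use finite_ground indep_subset empty_indep indep_mono in \<open>auto simp: mrestrict_def\<close>)
qed

lemma mrank_mrestrict: "T \<subseteq> S \<Longrightarrow> mrank (mrestrict M S) T = mrank M T"
  unfolding mrank_def mrestrict_def by (rule arg_cong[where f = "\<lambda>A. Max (card ` A)"]) auto

lemma binary_matroids_mrestrict:
  assumes "M \<in> binary_matroids n"
  shows "mrestrict M S \<in> binary_matroids n"
proof -
  have M: "matroid M" "card (ground M) \<le> n"
    using assms by (auto simp: binary_matroids_def)
  obtain d f where f: "matroid_morphism M (complete_binary d) f"
    using assms by (auto simp: binary_matroids_def binary_def)
  have "matroid_morphism (mrestrict M S) (complete_binary d) (restrict f (ground M \<inter> S))"
    unfolding matroid_morphism_def
  proof (intro conjI allI impI)
    show "restrict f (ground M \<inter> S) \<in> ground (mrestrict M S) \<rightarrow>\<^sub>E ground (complete_binary d)"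
      using f by (auto simp: matroid_morphism_def mrestrict_def)
  next
    fix T
    assume "T \<subseteq> ground (mrestrict M S)"
    then have T: "T \<subseteq> ground M" "T \<subseteq> S"
      by (auto simp: mrestrict_def)
    then have "restrict f (ground M \<inter> S) ` T = f ` T"
      by (intro image_cong) auto
    then show "mrank (complete_binary d) (restrict f (ground M \<inter> S) ` T) = mrank (mrestrict M S) T"
      using f T by (simp add: matroid_morphism_def mrank_mrestrict)
  qed
  moreover have "card (ground M \<inter> S) \<le> card (ground M)"
    using M(1) by (intro card_mono) (auto simp: matroid.finite_ground)
  ultimately show ?thesis
    using M matroid_mrestrict[of M S]
    by (auto simp: binary_matroids_def binary_def mrestrict_def)
qed

end

theory Submission imports Defs begin

text \<open>
  A binary representation \<open>g\<close> of \<open>M\<close> is determined up to a linear isomorphism by \<open>M\<close>. Given an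
  ordering, the elements that are not in the closure of their predecessors form a basis \<open>B\<close>, and
  we normalise \<open>g\<close> so that the basis element in position \<open>q\<close> goes to the standard basis vector with
  index \<open>q - 1\<close>. Over the two-element field the coordinate of \<open>x\<close> at \<open>b \<in> B\<close> is \<open>1\<close> iff \<open>b\<close> is in the fundamental
  circuit of \<open>x\<close>, and it is enough to form that circuit in the part of \<open>B\<close> up to the position of \<open>x\<close>.
  Hence the normalised image of \<open>x\<close> can be read off from the ranks of sets of elements that are
  not later than \<open>x\<close>, which makes it invariant under passing to prefixes.
\<close>

section \<open>Dimension, coordinates and greedy bases in a vector space\<close>

context vector_space
begin

lemma dim_insert_notin_span:
  assumes "finite S" "v \<notin> span S"
  shows "dim (insert v S) = Suc (dim S)"
proof -
  obtain B where B: "B \<subseteq> S" "independent B" "S \<subseteq> span B" "card B = dim S"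
    by (rule basis_exists)
  have span: "span B = span S"
    using B by (metis span_mono span_span subset_antisym)
  then have "independent (insert v B)" "v \<notin> B"
    using B assms by (auto simp: independent_insert span_base)
  moreover have "span (insert v B) = span (insert v S)"
    using span by (simp add: span_insert)
  ultimately have "dim (insert v S) = card (insert v B)"
    by (intro dim_eq_card)
  then show ?thesis
    using B \<open>v \<notin> B\<close> assms by (simp add: finite_subset)
qed

lemma dim_insert_eq_iff:
  assumes "finite S"
  shows "dim (insert v S) = dim S \<longleftrightarrow> v \<in> span S"
  using dim_insert_notin_span[OF assms, of v] span_redundant[of v S] by (metis dim_span n_not_Suc_n)

text \<open>Turns the vanishing of a coordinate into span membership, which ranks can detect. As
  \<open>v\<close> lies in the span of \<open>C\<close>, its coordinates over \<open>B\<close> are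
  those over \<open>C\<close>, so the small set \<open>C\<close> decides.\<close>

lemma representation_eq_0_iff:
  assumes "independent B" "C \<subseteq> B" "v \<in> span C" "b \<in> C"
  shows "representation B v b = 0 \<longleftrightarrow> v \<in> span (C - {b})"
proof -
  have C: "independent C"
    using assms independent_mono by blast
  have eq: "representation B v = representation C v"
    using assms by (intro representation_extend)
  show ?thesis
  proof
    assume "representation B v b = 0"
    then have "{a. representation C v a \<noteq> 0} \<subseteq> C - {b}"
      using eq representation_ne_zero[of C v] by auto
    then have "(\<Sum>a | representation C v a \<noteq> 0. representation C v a *s a) \<in> span (C - {b})"
      by (intro span_sum span_scale span_base) blast
    then show "v \<in> span (C - {b})"
      using sum_nonzero_representation_eq[OF C assms(3)] by simp
  next
    assume "v \<in> span (C - {b})"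
    then have "representation C v = representation (C - {b}) v"
      using C by (intro representation_extend) auto
    then show "representation B v b = 0"
      using eq representation_ne_zero[of "C - {b}" v b] by auto
  qed
qed

text \<open>Indices are collected, since \<open>w\<close> may repeat values; a repeated vector lies
  in the span of earlier ones and is skipped, whence injectivity. Each induction step meets a
  redundant vector or extends the basis.\<close>

lemma greedy_basis:
  fixes w :: "nat \<Rightarrow> 'b"
  defines "G \<equiv> \<lambda>p. {q \<in> {1..p}. w q \<notin> span (w ` {1..<q})}"
  shows "independent (w ` G p)" "inj_on w (G p)" "span (w ` G p) = span (w ` {1..p})"
proof -
  have "independent (w ` G p) \<and> inj_on w (G p) \<and> span (w ` G p) = span (w ` {1..p})"
  proof (induction p)
    case 0
    have "G 0 = {}"
      by (auto simp: G_def)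
    then show ?case
      by (simp add: independent_empty)
  next
    case (Suc p)
    have atLeastAtMost_Suc: "{1..Suc p} = insert (Suc p) {1..p}" "{1..<Suc p} = {1..p}"
      by auto
    show ?case
    proof (cases "w (Suc p) \<in> span (w ` {1..p})")
      case True
      then have "G (Suc p) = G p"
        by (auto simp: G_def le_Suc_eq atLeastAtMost_Suc(2) simp del: One_nat_def)
      then show ?thesis
        using Suc True unfolding atLeastAtMost_Suc(1) by (simp add: span_redundant)
    next
      case False
      then have "G (Suc p) = insert (Suc p) (G p)"
        by (auto simp: G_def le_Suc_eq atLeastAtMost_Suc(2) simp del: One_nat_def)
      moreover have "w (Suc p) \<notin> w ` G p" "w (Suc p) \<notin> span (w ` G p)"
        using False Suc span_base by auto
      ultimately show ?thesis
        using Suc unfolding atLeastAtMost_Suc(1)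
        by (auto simp: independent_insert span_insert)
    qed
  qed
  then show "independent (w ` G p)" "inj_on w (G p)" "span (w ` G p) = span (w ` {1..p})"
    by auto
qed

end

section \<open>Dimension under linear maps, and rank as dimension\<close>

lemma bvec_dim_image:
  assumes T: "Vector_Spaces.linear bscale bscale T" and inj: "inj_on T (bvec.span S)"
  shows "bvec.dim (T ` S) = bvec.dim S"
proof -
  interpret T: Vector_Spaces.linear bscale bscale T
    by fact
  obtain B where B: "B \<subseteq> S" "bvec.independent B" "S \<subseteq> bvec.span B" "card B = bvec.dim S"
    by (rule bvec.basis_exists)
  have span: "bvec.span B = bvec.span S"
    using B by (metis bvec.span_mono bvec.span_span subset_antisym)
  have "bvec.independent (T ` B)"
    using B(2) inj span by (intro T.independent_inj_on_image) auto
  moreover have "bvec.span (T ` B) = bvec.span (T ` S)"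
    using span by (simp add: T.span_image)
  ultimately have "bvec.dim (T ` S) = card (T ` B)"
    by (intro bvec.dim_eq_card)
  also have "\<dots> = card B"
    using inj span bvec.span_superset[of B] by (intro card_image) (auto intro: inj_on_subset)
  finally show ?thesis
    using B by simp
qed

lemma mrank_complete_binary:
  assumes "X \<subseteq> ground (complete_binary n)"
  shows "mrank (complete_binary n) X = bvec.dim X"
proof -
  have fin: "finite X"
    using assms finite_bvec_space[of n]
    by (auto simp: complete_binary_def Let_def intro: finite_subset)
  have indep: "Y \<in> indep (complete_binary n) \<longleftrightarrow> bvec.independent Y" if "Y \<subseteq> X" for Y
    using that assms by (auto simp: complete_binary_def Let_def)
  obtain B where B: "B \<subseteq> X" "bvec.independent B" "X \<subseteq> bvec.span B" "card B = bvec.dim X"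
    by (rule bvec.basis_exists)
  show ?thesis
    unfolding mrank_def
  proof (rule Max_eqI)
    show "finite (card ` {Y. Y \<subseteq> X \<and> Y \<in> indep (complete_binary n)})"
      using fin by auto
    show "bvec.dim X \<in> card ` {Y. Y \<subseteq> X \<and> Y \<in> indep (complete_binary n)}"
      using B indep by (intro image_eqI[of _ _ B]) auto
  next
    fix k
    assume "k \<in> card ` {Y. Y \<subseteq> X \<and> Y \<in> indep (complete_binary n)}"
    then obtain Y where Y: "Y \<subseteq> X" "bvec.independent Y" "k = card Y"
      using indep by auto
    have "finite B"
      using B fin by (auto intro: finite_subset)
    then show "k \<le> bvec.dim X"
      using bvec.independent_span_bound[of B Y] Y B by auto
  qed
qed

section \<open>The map defined from ranks\<close>

definition greedy :: "'a matroid \<Rightarrow> (nat \<Rightarrow> 'a) \<Rightarrow> nat \<Rightarrow> nat set" where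
  "greedy M \<pi> p = {q \<in> {1..p}. mrank M (\<pi> ` {1..q}) \<noteq> mrank M (\<pi> ` {1..<q})}"

text \<open>The rank condition says that exchanging \<open>Suc i\<close> for \<open>p\<close> in the
  greedy basis of the first \<open>p\<close> elements gives a basis again. If \<open>p\<close> is
  itself greedy, this yields the unit vector with index \<open>p - 1\<close>. Positions start at 1
  and coordinates at 0, hence \<open>Suc i\<close>.\<close>

definition greedy_coords :: "'a matroid \<Rightarrow> (nat \<Rightarrow> 'a) \<Rightarrow> nat \<Rightarrow> nat \<Rightarrow> bit" where
  "greedy_coords M \<pi> p = (\<lambda>i. of_bool (Suc i \<in> greedy M \<pi> p \<and>
     mrank M (\<pi> ` insert p (greedy M \<pi> p - {Suc i})) = card (greedy M \<pi> p)))"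

definition greedy_map :: "'a matroid \<Rightarrow> (nat \<Rightarrow> 'a) \<Rightarrow> 'a \<Rightarrow> nat \<Rightarrow> bit" where
  "greedy_map M \<pi> = restrict
     (\<lambda>x. greedy_coords M \<pi> (inv_into {1..card (ground M)} \<pi> x)) (ground M)"

section \<open>Invariance under prefixes\<close>

lemma mrank_mrestrict_image:
  assumes "A \<subseteq> K"
  shows "mrank (mrestrict M (\<pi> ` K)) (restrict \<pi> K ` A) = mrank M (\<pi> ` A)"
proof -
  have "restrict \<pi> K ` A = \<pi> ` A"
    using assms by (intro image_cong) auto
  then show ?thesis
    using assms by (metis image_mono mrank_mrestrict)
qed

lemma greedy_mrestrict:
  assumes "p \<le> k"
  shows "greedy (mrestrict M (\<pi> ` {1..k})) (restrict \<pi> {1..k}) p = greedy M \<pi> p"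
  unfolding greedy_def
proof (intro Collect_cong conj_cong refl)
  fix q
  assume "q \<in> {1..p}"
  then have "{1..q} \<subseteq> {1..k}" "{1..<q} \<subseteq> {1..k}"
    using assms by auto
  then show "(mrank (mrestrict M (\<pi> ` {1..k})) (restrict \<pi> {1..k} ` {1..q}) \<noteq>
      mrank (mrestrict M (\<pi> ` {1..k})) (restrict \<pi> {1..k} ` {1..<q})) =
    (mrank M (\<pi> ` {1..q}) \<noteq> mrank M (\<pi> ` {1..<q}))"
    by (simp only: mrank_mrestrict_image)
qed

text \<open>Only ranks of images of subsets of \<open>{1..p}\<close> enter, and the restriction
  keeps these.\<close>

lemma greedy_coords_mrestrict:
  assumes "p \<in> {1..k}"
  shows "greedy_coords (mrestrict M (\<pi> ` {1..k})) (restrict \<pi> {1..k}) p = greedy_coords M \<pi> p"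
proof -
  have "p \<le> k" "insert p (greedy M \<pi> p - A) \<subseteq> {1..k}" for A
    using assms by (auto simp: greedy_def)
  then show ?thesis
    by (simp only: greedy_coords_def greedy_mrestrict mrank_mrestrict_image)
qed

lemma greedy_map_mrestrict:
  assumes \<pi>: "ordering M \<pi>" and k: "k < card (ground M)"
  shows "greedy_map (mrestrict M (\<pi> ` {1..k})) (restrict \<pi> {1..k}) =
    restrict (greedy_map M \<pi>) (\<pi> ` {1..k})"
proof -
  let ?m = "card (ground M)"
  have bij: "inj_on \<pi> {1..?m}" "\<pi> ` {1..?m} = ground M"
    using \<pi> by (auto simp: ordering_def bij_betw_def)
  have sub: "{1..k} \<subseteq> {1..?m}"
    using k by auto
  have inj: "inj_on \<pi> {1..k}"
    using bij sub inj_on_subset by blast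
  have ground: "ground (mrestrict M (\<pi> ` {1..k})) = \<pi> ` {1..k}"
    using bij sub by (auto simp: mrestrict_def)
  have card: "card (\<pi> ` {1..k}) = k"
    using inj by (simp add: card_image)
  have "inv_into {1..k} (restrict \<pi> {1..k}) (\<pi> p) = p" "inv_into {1..?m} \<pi> (\<pi> p) = p"
    if "p \<in> {1..k}" for p
    using that inj bij sub inv_into_f_f[of "restrict \<pi> {1..k}" "{1..k}" p]
      inv_into_f_f[of \<pi> "{1..?m}" p] by (auto simp: inj_on_restrict_eq)
  moreover have "\<pi> ` {1..k} \<subseteq> ground M"
    using bij sub by blast
  ultimately show ?thesis
    unfolding greedy_map_def ground card
    by (intro ext) (auto simp: restrict_def[of _ "ground M"] restrict_def[of _ "\<pi> ` {1..k}"]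
        greedy_coords_mrestrict simp del: One_nat_def)
qed

section \<open>Preservation of rank\<close>

text \<open>On the ground set the greedy map is a representation \<open>g\<close> followed by a
  linear map \<open>T\<close>. As \<open>T\<close> is injective on the span of the image of
  \<open>g\<close>, it preserves dimensions and hence ranks.\<close>

lemma matroid_morphism_greedy_map:
  assumes M: "M \<in> binary_matroids n" and \<pi>: "ordering M \<pi>"
  shows "matroid_morphism M (complete_binary n) (greedy_map M \<pi>)"
proof -
  obtain d g where g: "matroid_morphism M (complete_binary d) g" and n: "card (ground M) \<le> n"
    using M by (auto simp: binary_matroids_def binary_def)
  define m where "m = card (ground M)"
  have bij: "inj_on \<pi> {1..m}" "\<pi> ` {1..m} = ground M"
    using \<pi> by (auto simp: ordering_def bij_betw_def m_def)
  have rank: "mrank M S = bvec.dim (g ` S)" if "S \<subseteq> ground M" for S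
  proof -
    have "g ` S \<subseteq> ground (complete_binary d)"
      using g that by (auto simp: matroid_morphism_def)
    then show ?thesis
      using g that mrank_complete_binary[of "g ` S" d] by (simp add: matroid_morphism_def)
  qed
  define w where "w = g \<circ> \<pi>"
  have rank_w: "mrank M (\<pi> ` A) = bvec.dim (w ` A)" if "A \<subseteq> {1..m}" for A
    using rank[of "\<pi> ` A"] that bij(2) by (auto simp: w_def image_comp image_mono)
  have greedy: "greedy M \<pi> p = {q \<in> {1..p}. w q \<notin> bvec.span (w ` {1..<q})}" if "p \<le> m" for p
  proof -
    have "mrank M (\<pi> ` {1..q}) = mrank M (\<pi> ` {1..<q}) \<longleftrightarrow> w q \<in> bvec.span (w ` {1..<q})"
      if "q \<in> {1..m}" for q
    proof -
      have "{1..q} = insert q {1..<q}"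
        using that by auto
      then have "w ` {1..q} = insert (w q) (w ` {1..<q})" "{1..q} \<subseteq> {1..m}" "{1..<q} \<subseteq> {1..m}"
        using that by auto
      then show ?thesis
        using bvec.dim_insert_eq_iff[of "w ` {1..<q}" "w q"]
        by (metis rank_w finite_imageI finite_atLeastLessThan)
    qed
    then show ?thesis
      using that by (auto simp: greedy_def)
  qed
  have G: "bvec.independent (w ` greedy M \<pi> p)" "inj_on w (greedy M \<pi> p)"
    "bvec.span (w ` greedy M \<pi> p) = bvec.span (w ` {1..p})" if "p \<le> m" for p
    using bvec.greedy_basis[of w p] that by (simp_all add: greedy)
  \<comment> \<open>\<open>representation\<close> is linear only on the span of the basis, so the
    greedy basis is extended to one of the whole space to make \<open>T\<close> linear
    everywhere.\<close>
  define E where "E = bvec.extend_basis (w ` greedy M \<pi> m)"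
  have E: "bvec.independent E" "w ` greedy M \<pi> m \<subseteq> E" "bvec.span E = UNIV"
    using G(1)[of m] by (simp_all add: E_def bvec.independent_extend_basis
        bvec.extend_basis_superset)
  \<comment> \<open>\<open>T\<close> sends \<open>w q\<close> for greedy \<open>q\<close> to the
    unit vector with index \<open>q - 1\<close> and kills the rest of \<open>E\<close>; hence
    injectivity is claimed only on the span of the greedy vectors.\<close>
  define T where
    "T = (\<lambda>v i. if Suc i \<in> greedy M \<pi> m then bvec.representation E v (w (Suc i)) else 0)"
  have T: "Vector_Spaces.linear bscale bscale T"
  proof unfold_locales
    show "T (u + v) = T u + T v" for u v
      using E bvec.representation_add[OF E(1), of v u] by (simp add: T_def fun_eq_iff)
    show "T (bscale c v) = bscale c (T v)" for c v
    proof
      fix i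
      show "T (bscale c v) i = bscale c (T v) i"
        unfolding bscale_def[of c "T v"]
        using E bvec.representation_scale[OF E(1), of v c] by (simp add: T_def)
    qed
  qed
  interpret T: Vector_Spaces.linear bscale bscale T
    by (rule T)
  have span_w: "bvec.span (w ` greedy M \<pi> m) = bvec.span (g ` ground M)"
    using G(3)[of m] unfolding w_def bij(2)[symmetric] by (simp only: image_comp order_refl)
  have inj: "inj_on T (bvec.span (g ` ground M))"
    unfolding span_w[symmetric]
  proof (rule T.inj_on_iff_eq_0[OF bvec.subspace_span, THEN iffD2], intro ballI impI)
    fix v
    assume v: "v \<in> bvec.span (w ` greedy M \<pi> m)" and "T v = 0"
    \<comment> \<open>Coordinates at greedy vectors are entries of \<open>T v\<close>; all others
      vanish because \<open>v\<close> is in the span of the greedy vectors.\<close>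
    have "bvec.representation E v b = 0" for b
    proof (cases "b \<in> w ` greedy M \<pi> m")
      case True
      then obtain q where q: "q \<in> greedy M \<pi> m" "b = w q"
        by auto
      then have "Suc (q - 1) = q"
        by (auto simp: greedy_def)
      then show ?thesis
        using q fun_cong[OF \<open>T v = 0\<close>, of "q - 1"] by (simp add: T_def)
    next
      case False
      then show ?thesis
        using bvec.representation_ne_zero[of "w ` greedy M \<pi> m" v b]
          bvec.representation_extend[OF E(1) v E(2)] by auto
    qed
    then show "v = 0"
      using bvec.sum_nonzero_representation_eq[OF E(1), of v] E(3) by simp
  qed
  \<comment> \<open>The left side uses the greedy basis of a prefix, \<open>T\<close> that of all of
    \<open>M\<close>. They agree since \<open>w p\<close> already lies in the span of the prefix
    basis \<open>?C\<close>.\<close>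
  have coords: "greedy_coords M \<pi> p = T (w p)" if p: "p \<in> {1..m}" for p
  proof
    fix i
    let ?C = "w ` greedy M \<pi> p"
    have "p \<le> m"
      using p by simp
    note Gp = G[OF this]
    have sub: "greedy M \<pi> p \<subseteq> greedy M \<pi> m" "greedy M \<pi> p \<subseteq> {1..m}" "finite (greedy M \<pi> p)"
      using p by (auto simp: greedy_def)
    have wp: "w p \<in> bvec.span ?C"
      using p unfolding Gp(3) by (intro bvec.span_base) auto
    have CE: "?C \<subseteq> E"
      using E(2) sub by auto
    show "greedy_coords M \<pi> p i = T (w p) i"
    proof (cases "Suc i \<in> greedy M \<pi> p")
      case True
      let ?D = "greedy M \<pi> p - {Suc i}"
      have D: "w ` ?D = ?C - {w (Suc i)}"
        using Gp(2) True by (auto simp: inj_on_def)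
      have "bvec.independent (w ` ?D)"
        using Gp(1) unfolding D by (rule bvec.independent_mono) auto
      moreover have "card (w ` ?D) = card ?D"
        using Gp(2) by (intro card_image) (auto intro: inj_on_subset)
      \<comment> \<open>Removing one basis vector lowers the dimension by one; \<open>w p\<close>
        makes up for it exactly when it lies outside the remaining span.\<close>
      ultimately have "card (greedy M \<pi> p) = Suc (bvec.dim (w ` ?D))"
        using True sub card_Suc_Diff1[of "greedy M \<pi> p" "Suc i"]
        by (simp add: bvec.dim_eq_card_independent)
      moreover have "mrank M (\<pi> ` insert p ?D) = bvec.dim (insert (w p) (w ` ?D))"
        using rank_w[of "insert p ?D"] p sub by auto
      ultimately have "mrank M (\<pi> ` insert p ?D) = card (greedy M \<pi> p) \<longleftrightarrow>
          w p \<notin> bvec.span (w ` ?D)"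
        using bvec.dim_insert_notin_span[of "w ` ?D" "w p"] sub
          bvec.dim_insert_eq_iff[of "w ` ?D" "w p"] by auto
      also have "\<dots> \<longleftrightarrow> bvec.representation E (w p) (w (Suc i)) \<noteq> 0"
        using bvec.representation_eq_0_iff[OF E(1) CE wp, of "w (Suc i)"] True D by simp
      \<comment> \<open>Over \<open>bit\<close> a nonzero coordinate is 1, so knowing whether it
        vanishes determines it.\<close>
      finally show ?thesis
        using True sub by (auto simp: greedy_coords_def T_def)
    next
      case False
      \<comment> \<open>Such a position is later than \<open>p\<close>, so its vector is not among
        those spanning \<open>w p\<close>.\<close>
      have "bvec.representation E (w p) (w (Suc i)) = 0" if "Suc i \<in> greedy M \<pi> m"
      proof -
        have "w (Suc i) \<notin> ?C"
          using that False sub G(2)[of m] by (auto simp: inj_on_def)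
        then show ?thesis
          using bvec.representation_ne_zero[of ?C "w p" "w (Suc i)"]
            bvec.representation_extend[OF E(1) wp CE] by auto
      qed
      then show ?thesis
        using False by (simp add: greedy_coords_def T_def)
    qed
  qed
  have map: "greedy_map M \<pi> x = T (g x)" if "x \<in> ground M" for x
  proof -
    have "inv_into {1..m} \<pi> x \<in> {1..m}" "\<pi> (inv_into {1..m} \<pi> x) = x"
      using that bij(2) inv_into_into[of x \<pi> "{1..m}"] f_inv_into_f[of x \<pi> "{1..m}"] by auto
    then show ?thesis
      using that coords by (simp add: greedy_map_def m_def[symmetric] w_def)
  qed
  \<comment> \<open>Greedy positions are at most \<open>card (ground M)\<close>, hence at most
    \<open>n\<close>, so nonzero entries have index below \<open>n\<close>.\<close>
  have in_ground: "T v \<in> ground (complete_binary n)" for v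
    using n by (auto simp: T_def complete_binary_def Let_def greedy_def m_def)
  show ?thesis
    unfolding matroid_morphism_def
  proof (intro conjI allI impI)
    show "greedy_map M \<pi> \<in> ground M \<rightarrow>\<^sub>E ground (complete_binary n)"
      using map in_ground by (auto simp: PiE_iff greedy_map_def)
  next
    fix S
    assume S: "S \<subseteq> ground M"
    have "greedy_map M \<pi> ` S = T ` g ` S"
      unfolding image_image using S map by (intro image_cong) auto
    moreover have "T ` g ` S \<subseteq> ground (complete_binary n)"
      using in_ground by auto
    moreover have "inj_on T (bvec.span (g ` S))"
      using inj S by (meson bvec.span_mono image_mono inj_on_subset)
    ultimately show "mrank (complete_binary n) (greedy_map M \<pi> ` S) = mrank M S"
      using S by (simp add: mrank_complete_binary bvec_dim_image[OF T] rank)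
  qed
qed

theorem theorem1:
  fixes n :: nat
  assumes "n > 0"
  shows "\<exists>f :: 'a matroid \<Rightarrow> (nat \<Rightarrow> 'a) \<Rightarrow> 'a \<Rightarrow> (nat \<Rightarrow> bit).
    online_morphism (binary_matroids n) (complete_binary n) f"
  by (rule exI[of _ greedy_map])
    (simp add: online_morphism_def matroid_morphism_greedy_map greedy_map_mrestrict
      del: One_nat_def)

end
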